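(* If Meyniel's conjecture is false, then at least one of the following holds: (a) every family of graphs $\{G_n\}_{n\in I}$, where $G_n$ has order $n$, satisfies $c(G_n)=O(\sqrt n\log n)$; or (b) there is a family of graphs $\{G_n\}_{n\in I}$, where $G_n$ has order $n$, such that $G_n$ has cop number $\omega(\sqrt n\log n)$ and has $\omega(\sqrt n)$ vertices of degree $o(\sqrt n)$.
   Context: All graphs are finite, simple, undirected and connected; $I$ denotes an infinite set of positive integers (possibly different for different families); asymptotics are as $n\to\infty$ in $I$; logarithms are base $2$. Here $g=\omega(h)$ means $g(n)/h(n)\to\infty$. "$G_n$ has $\omega(\sqrt n)$ vertices of degree $o(\sqrt n)$" means that there is a function $f(n)=o(\sqrt n)$ such that the number of vertices of $G_n$ of degree at most $f(n)$ is $\omega(\sqrt n)$. Meyniel's conjecture: there is a constant $D>0$ such that $c(G)\le D\sqrt n$ for every connected graph $G$ of order $n$. Cops and Robbers on a graph $G$: in round $0$ the cops choose vertices to occupy, then the robber chooses a vertex. In each later round the cops move first and then the robber. On a move, each player moves to a neighboring vertex or stays put; any subset of the cops may move. Both sides have complete information. The cops win if after finitely many rounds some cop occupies the robber's vertex; otherwise the robber wins. The cop number $c(G)$ is the minimum number of cops that guarantees a win for the cops. *)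

theory Defs
  imports "Graph_Theory.Digraph_Component" "HOL-Library.Landau_Symbols"
begin

(* A simple undirected graph is a finite, loop-free, symmetric set of ordered pairs
   (locale pair_graph). Vertices are natural numbers, which covers every finite graph up to
   isomorphism. The qualified name is needed because of the topological notion "connected";
   connected graphs are non-empty. *)
definition connected_graph :: "nat pair_pre_digraph \<Rightarrow> bool" where
  "connected_graph G \<longleftrightarrow> pair_graph G \<and> Digraph_Component.connected (with_proj G)"

definition can_move :: "'a pair_pre_digraph \<Rightarrow> 'a \<Rightarrow> 'a \<Rightarrow> bool" where
  "can_move G u v \<longleftrightarrow> u = v \<or> (u, v) \<in> parcs G"

(* R t is the robber's vertex at the end of round t. *)
definition robber_play :: "'a pair_pre_digraph \<Rightarrow> (nat \<Rightarrow> 'a) \<Rightarrow> bool" where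
  "robber_play G R \<longleftrightarrow> (\<forall>t. R t \<in> pverts G \<and> can_move G (R t) (R (Suc t)))"

(* A cop strategy maps the robber's vertices in rounds 0, ..., t - 1 to the list of the cops'
   vertices in round t (the i-th entry belongs to the i-th cop); its value at the empty list is
   the initial placement. The cops' own earlier positions are determined by the strategy and
   this history, so they need not be recorded in it. *)
type_synonym 'a cop_strategy = "'a list \<Rightarrow> 'a list"

definition cops_at :: "'a cop_strategy \<Rightarrow> (nat \<Rightarrow> 'a) \<Rightarrow> nat \<Rightarrow> 'a list" where
  "cops_at \<sigma> R t = \<sigma> (map R [0..<t])"

definition legal_cops :: "'a pair_pre_digraph \<Rightarrow> nat \<Rightarrow> (nat \<Rightarrow> 'a list) \<Rightarrow> bool" where
  "legal_cops G k C \<longleftrightarrow>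
     (\<forall>t. length (C t) = k \<and> set (C t) \<subseteq> pverts G \<and>
          (\<forall>i<k. can_move G (C t ! i) (C (Suc t) ! i)))"

(* The robber is caught in round t after his own placement or move, or in round t + 1 after the
   cops' move. Plays are continued past a capture, where moves no longer matter: either side
   can always stay put. *)
definition captured :: "(nat \<Rightarrow> 'a list) \<Rightarrow> (nat \<Rightarrow> 'a) \<Rightarrow> bool" where
  "captured C R \<longleftrightarrow> (\<exists>t. R t \<in> set (C t) \<or> R t \<in> set (C (Suc t)))"

definition cops_can_win :: "'a pair_pre_digraph \<Rightarrow> nat \<Rightarrow> bool" where
  "cops_can_win G k \<longleftrightarrow>
     (\<exists>\<sigma>. \<forall>R. robber_play G R \<longrightarrow> legal_cops G k (cops_at \<sigma> R) \<and> captured (cops_at \<sigma> R) R)"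

definition cop_number :: "'a pair_pre_digraph \<Rightarrow> nat" where
  "cop_number G = (LEAST k. cops_can_win G k)"

definition meyniel_conjecture :: bool where
  "meyniel_conjecture \<longleftrightarrow>
     (\<exists>D>0::real. \<forall>G. connected_graph G \<longrightarrow>
        real (cop_number G) \<le> D * sqrt (real (card (pverts G))))"

definition graph_family :: "nat set \<Rightarrow> (nat \<Rightarrow> nat pair_pre_digraph) \<Rightarrow> bool" where
  "graph_family I G \<longleftrightarrow>
     infinite I \<and> I \<subseteq> {1..} \<and> (\<forall>n\<in>I. connected_graph (G n) \<and> card (pverts (G n)) = n)"

(* The filter "n tends to infinity in I". *)
definition at_top_in :: "nat set \<Rightarrow> nat filter" where
  "at_top_in I = inf at_top (principal I)"

(* The number of vertices of degree at most d; the out-degree of a vertex of a symmetric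
   digraph is its degree in the undirected graph. *)
definition num_low_degree :: "'a pair_pre_digraph \<Rightarrow> real \<Rightarrow> nat" where
  "num_low_degree G d = card {v \<in> pverts G. real (out_degree (with_proj G) v) \<le> d}"

end

theory Submission
  imports Defs
begin

text \<open>
  The theorem holds because of a trade-off between low and high degrees. Cops who occupy a
  dominating set win with their first move. If one cop is placed on every vertex of degree at
  most \<open>d\<close>, the remaining vertices have neighbourhoods with more than \<open>d\<close> elements, and a
  greedy choice hits all of these with roughly \<open>(n / d) ln n\<close> further cops. Hence a graph with
  \<open>n\<close> vertices, \<open>m\<close> of which have degree at most \<open>d\<close>, has cop number at most
  \<open>m + (n / d) ln n + 1\<close>; this is the lemma \<open>cop_number_le_low_degree\<close>.

  Suppose that (a) fails. Restricting the index set (lemma \<open>not_bigo_imp_smallomega_subset\<close>)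
  yields a family with \<open>c(G\<^sub>n) = h(n) \<surd>n log n\<close> and \<open>h(n) \<rightarrow> \<infinity>\<close>. Let \<open>d = \<surd>n / \<surd>h(n)\<close>, which
  is \<open>o(\<surd>n)\<close>. The greedy part then uses at most about \<open>\<surd>h(n) \<surd>n log n\<close> cops, which is of
  smaller order than the cop number. So nearly all of the bound is paid for by the vertices of
  degree at most \<open>d\<close>: there are at least \<open>(h(n) - \<surd>h(n)) \<surd>n log n - 1 = \<omega>(\<surd>n)\<close> of them, and
  the same family witnesses (b).
\<close>

section \<open>Greedy hitting sets\<close>

text \<open>
  Averaging, the greedy step: there are at least \<open>d * card U\<close> incidences between elements
  and sets, and they are shared among the \<open>card V\<close> elements.
\<close>

lemma element_in_many_sets:
  fixes N :: "'b \<Rightarrow> 'a set" and d :: real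
  assumes V: "finite V" "V \<noteq> {}" and U: "finite U"
    and N: "\<And>v. v \<in> U \<Longrightarrow> N v \<subseteq> V" "\<And>v. v \<in> U \<Longrightarrow> d \<le> card (N v)"
  shows "\<exists>x\<in>V. d / card V * card U \<le> card {v \<in> U. x \<in> N v}"
proof (rule ccontr)
  assume "\<not> ?thesis"
  then have "(\<Sum>x\<in>V. real (card {v \<in> U. x \<in> N v})) < (\<Sum>x\<in>V. d / card V * card U)"
    using V by (intro sum_strict_mono) (auto simp: not_le)
  also have "\<dots> = d * card U"
    using V by simp
  also have "\<dots> \<le> (\<Sum>v\<in>U. real (card (N v)))"
    using sum_mono[of U "\<lambda>_. d" "\<lambda>v. real (card (N v))"] N(2) by (simp add: mult.commute)
  also have "\<dots> = (\<Sum>v\<in>U. real (card {x \<in> V. x \<in> N v}))"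
    using N(1) by (intro sum.cong refl arg_cong[of _ _ "\<lambda>A. real (card A)"]) auto
  also have "\<dots> = (\<Sum>x\<in>V. real (card {v \<in> U. x \<in> N v}))"
    using sum_multicount_gen[OF V(1) U, of "\<lambda>x v. x \<in> N v"
        "\<lambda>v. card {x \<in> V. x \<in> N v}"]
    by (simp flip: of_nat_sum)
  finally show False by simp
qed

lemma greedy_hitting_decay:
  fixes N :: "'b \<Rightarrow> 'a set" and d :: real
  assumes V: "finite V" "V \<noteq> {}" and H: "finite H"
    and N: "\<And>v. v \<in> H \<Longrightarrow> N v \<subseteq> V" "\<And>v. v \<in> H \<Longrightarrow> d \<le> card (N v)"
  shows "\<exists>S\<subseteq>V. card S \<le> t \<and>
           real (card {v \<in> H. N v \<inter> S = {}}) \<le> card H * (1 - d / card V) ^ t"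
proof (induction t)
  case 0
  show ?case by (intro exI[of _ "{}"]) simp
next
  case (Suc t)
  show ?case
  proof (cases "H = {}")
    case True
    then show ?thesis by (intro exI[of _ "{}"]) simp
  next
    case False
    then obtain w where "w \<in> H" by blast
    then have "d \<le> card V"
      using N V(1) card_mono[of V "N w"] by fastforce
    then have q: "0 \<le> 1 - d / card V"
      using V by (simp add: field_simps)
    from Suc obtain S where S: "S \<subseteq> V" "card S \<le> t"
      and dec: "real (card {v \<in> H. N v \<inter> S = {}}) \<le> card H * (1 - d / card V) ^ t"
      by blast
    define U where "U = {v \<in> H. N v \<inter> S = {}}"
    have "finite U" using H by (simp add: U_def)
    then obtain x where x: "x \<in> V" "d / card V * card U \<le> card {v \<in> U. x \<in> N v}"
      using element_in_many_sets[of V U N d] V N by (auto simp: U_def)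
    have split: "{v \<in> H. N v \<inter> insert x S = {}} = U - {v \<in> U. x \<in> N v}"
      by (auto simp: U_def)
    have "card {v \<in> U. x \<in> N v} \<le> card U"
      using \<open>finite U\<close> by (intro card_mono) auto
    then have "real (card {v \<in> H. N v \<inter> insert x S = {}}) =
        card U - real (card {v \<in> U. x \<in> N v})"
      using \<open>finite U\<close> unfolding split by (subst card_Diff_subset) auto
    also have "\<dots> \<le> (1 - d / card V) * card U"
      using x(2) by (simp add: algebra_simps)
    also have "\<dots> \<le> (1 - d / card V) * (card H * (1 - d / card V) ^ t)"
      using dec q unfolding U_def by (rule mult_left_mono)
    finally have "real (card {v \<in> H. N v \<inter> insert x S = {}})
        \<le> card H * (1 - d / card V) ^ Suc t" by (simp add: mult_ac)
    moreover have "card (insert x S) \<le> Suc t"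
      using S card_insert_le_m1[of "Suc t" S x] by simp
    ultimately show ?thesis
      using S x(1) by (intro exI[of _ "insert x S"]) simp
  qed
qed

text \<open>
  Once the geometric decay has brought the number of sets missed below 1, it is 0. By
  \<open>1 - q \<le> exp (- q)\<close> this takes just over \<open>(card V / d) ln (card H)\<close> steps.
\<close>

lemma small_hitting_set:
  fixes N :: "'b \<Rightarrow> 'a set" and d :: real
  assumes V: "finite V" "V \<noteq> {}" and H: "finite H" and d: "d > 0"
    and N: "\<And>v. v \<in> H \<Longrightarrow> N v \<subseteq> V" "\<And>v. v \<in> H \<Longrightarrow> d \<le> card (N v)"
  shows "\<exists>S\<subseteq>V. real (card S) \<le> card V / d * ln (card H) + 1 \<and> (\<forall>v\<in>H. N v \<inter> S \<noteq> {})"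
proof (cases "H = {}")
  case True
  then show ?thesis by (intro exI[of _ "{}"]) simp
next
  case False
  define q where "q = d / card V"
  have q: "q > 0" using d V by (simp add: q_def card_gt_0_iff)
  have H1: "real (card H) \<ge> 1"
    using False H by (simp add: Suc_le_eq card_gt_0_iff)
  obtain w where "w \<in> H" using False by blast
  then have "d \<le> card V"
    using N V(1) card_mono[of V "N w"] by fastforce
  then have q1: "0 \<le> 1 - q"
    using V by (simp add: q_def field_simps)
  define t where "t = nat (\<lfloor>ln (card H) / q\<rfloor> + 1)"
  have "ln (real (card H)) / q \<ge> 0" using q H1 by simp
  then have t: "real t > ln (card H) / q" "real t \<le> ln (card H) / q + 1"
    unfolding t_def by linarith+
  have "\<exists>S\<subseteq>V. card S \<le> t \<and> real (card {v \<in> H. N v \<inter> S = {}}) \<le> card H * (1 - q) ^ t"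
    unfolding q_def using V H N by (rule greedy_hitting_decay)
  then obtain S where S: "S \<subseteq> V" "card S \<le> t"
    and dec: "real (card {v \<in> H. N v \<inter> S = {}}) \<le> card H * (1 - q) ^ t"
    by blast
  have "(1 - q) ^ t \<le> exp (- q) ^ t"
    using q1 exp_ge_add_one_self[of "- q"] by (intro power_mono) auto
  also have "\<dots> = exp (- (real t * q))"
    by (simp flip: exp_of_nat_mult)
  also have "\<dots> < exp (- ln (card H))"
    using t(1) q by (simp add: field_simps)
  also have "\<dots> = 1 / card H"
    using H1 unfolding exp_minus by (subst exp_ln) (linarith, simp add: divide_inverse)
  finally have "card H * (1 - q) ^ t < 1"
    using H1 by (simp add: field_simps)
  with dec have "card {v \<in> H. N v \<inter> S = {}} = 0" by linarith
  then have "\<forall>v\<in>H. N v \<inter> S \<noteq> {}"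
    using H by (auto simp: card_eq_0_iff)
  moreover have "real (card S) \<le> card V / d * ln (card H) + 1"
    using S(2) t(2) by (simp add: q_def mult.commute)
  ultimately show ?thesis using S(1) by blast
qed

section \<open>Dominating sets and low-degree vertices\<close>

text \<open>
  The cops start on a dominating set, and every cop who can step onto the robber's initial
  vertex does so. All later moves of the robber come after his capture.
\<close>

lemma cop_number_le_dominating:
  assumes fin: "finite S" and S: "S \<subseteq> pverts G"
    and dom: "\<And>v. v \<in> pverts G \<Longrightarrow> \<exists>u\<in>S. can_move G u v"
  shows "cop_number G \<le> card S"
proof -
  obtain xs where xs: "set xs = S" "length xs = card S"
    using fin finite_distinct_list distinct_card by metis
  define \<sigma> :: "'a cop_strategy" where
    "\<sigma> h = (if h = [] then xs else map (\<lambda>u. if can_move G u (hd h) then hd h else u) xs)" for h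
  have "legal_cops G (card S) (cops_at \<sigma> R) \<and> captured (cops_at \<sigma> R) R" if R: "robber_play G R" for R
  proof
    have start: "cops_at \<sigma> R 0 = xs"
      by (simp add: cops_at_def \<sigma>_def)
    have later: "cops_at \<sigma> R (Suc t) = map (\<lambda>u. if can_move G u (R 0) then R 0 else u) xs" for t
      by (simp add: cops_at_def \<sigma>_def hd_map del: upt_Suc)
    have R0: "R 0 \<in> pverts G" using R by (simp add: robber_play_def)
    have stay: "can_move G u u" for u by (simp add: can_move_def)
    show "legal_cops G (card S) (cops_at \<sigma> R)"
      unfolding legal_cops_def
    proof (intro allI)
      fix t
      show "length (cops_at \<sigma> R t) = card S \<and> set (cops_at \<sigma> R t) \<subseteq> pverts G \<and>
          (\<forall>i<card S. can_move G (cops_at \<sigma> R t ! i) (cops_at \<sigma> R (Suc t) ! i))"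
        using xs S R0 stay by (cases t) (auto simp: start later)
    qed
    obtain u where "u \<in> S" "can_move G u (R 0)" using dom[OF R0] by blast
    then have "R 0 \<in> set (cops_at \<sigma> R (Suc 0))"
      using xs(1) by (force simp: later)
    then show "captured (cops_at \<sigma> R) R"
      unfolding captured_def by blast
  qed
  then have "cops_can_win G (card S)"
    unfolding cops_can_win_def by blast
  then show ?thesis
    unfolding cop_number_def by (rule Least_le)
qed

lemma out_degree_with_proj:
  "out_degree (with_proj G) v = card {u. (v, u) \<in> parcs G}"
proof -
  have "out_arcs (with_proj G) v = Pair v ` {u. (v, u) \<in> parcs G}"
    by (auto simp: out_arcs_def)
  then show ?thesis
    unfolding out_degree_def by (simp add: card_image inj_on_def)
qed

text \<open>
  The set of low-degree vertices, together with a set that hits the neighbourhoods of all the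
  others, is dominating.
\<close>

lemma cop_number_le_low_degree:
  fixes d :: real
  assumes G: "connected_graph G" and d: "d > 0"
  shows "cop_number G \<le>
           num_low_degree G d + card (pverts G) / d * ln (card (pverts G)) + 1"
proof -
  interpret pair_graph G using G by (simp add: connected_graph_def)
  define V where "V = pverts G"
  define N where "N v = {u. (v, u) \<in> parcs G}" for v
  define L where "L = {v \<in> V. real (out_degree (with_proj G) v) \<le> d}"
  have V: "finite V" "V \<noteq> {}"
    using G by (auto simp: V_def connected_graph_def Digraph_Component.connected_def
        strongly_connected_def)
  have N: "N v \<subseteq> V" "v \<in> V - L \<Longrightarrow> d \<le> card (N v)" for v
    using in_arcsD2 by (auto simp: N_def V_def L_def out_degree_with_proj)
  obtain S where S: "S \<subseteq> V" "real (card S) \<le> card V / d * ln (card (V - L)) + 1"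
    and hit: "\<forall>v\<in>V - L. N v \<inter> S \<noteq> {}"
    using small_hitting_set[OF V, of "V - L" d N] V d N by auto
  have "cop_number G \<le> card (L \<union> S)"
  proof (rule cop_number_le_dominating)
    show "finite (L \<union> S)" "L \<union> S \<subseteq> pverts G"
      using V finite_subset[OF S(1)] S(1) by (auto simp: L_def V_def)
    fix v assume v: "v \<in> pverts G"
    show "\<exists>u\<in>L \<union> S. can_move G u v"
    proof (cases "v \<in> L")
      case True
      then show ?thesis by (auto simp: can_move_def)
    next
      case False
      then obtain u where "u \<in> S" "(v, u) \<in> parcs G"
        using hit v by (auto simp: V_def N_def)
      then show ?thesis using arcs_symmetric by (auto simp: can_move_def)
    qed
  qed
  also have "\<dots> \<le> card L + card S" by (rule card_Un_le)
  finally have "real (cop_number G) \<le> card L + (card V / d * ln (card (V - L)) + 1)"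
    using S(2) by linarith
  moreover have "ln (real (card (V - L))) \<le> ln (card V)"
  proof (cases "V - L = {}")
    case True
    then show ?thesis using V by (simp only: True) (simp add: Suc_le_eq card_gt_0_iff)
  next
    case False
    then show ?thesis using V card_mono[of V "V - L"] by (simp add: card_gt_0_iff)
  qed
  then have "card V / d * ln (card (V - L)) \<le> card V / d * ln (card V)"
    using d by (intro mult_left_mono) auto
  ultimately show ?thesis
    by (simp add: num_low_degree_def L_def V_def)
qed

section \<open>Passing to a subset of the index set\<close>

lemma eventually_at_top_in:
  "eventually P (at_top_in I) \<longleftrightarrow> (\<exists>m. \<forall>n\<in>I. n \<ge> m \<longrightarrow> P n)"
  by (auto simp: at_top_in_def eventually_inf_principal eventually_at_top_linorder)

text \<open>
  Failure of \<open>f = O(g)\<close> produces, for each constant \<open>k\<close>, arbitrarily large indices at which \<open>f\<close>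
  exceeds \<open>k * g\<close>; an increasing choice of one index for each \<open>k\<close> is a diagonal sequence along which
  \<open>f\<close> dominates \<open>g\<close>.
\<close>

lemma not_bigo_imp_smallomega_subset:
  fixes f g :: "nat \<Rightarrow> real"
  assumes "f \<notin> O[at_top_in I](g)"
  shows "\<exists>J\<subseteq>I. infinite J \<and> f \<in> \<omega>[at_top_in J](g)"
proof -
  have large: "\<exists>n\<in>I. n \<ge> m \<and> norm (f n) > real k * norm (g n)" for m k :: nat
  proof (rule ccontr)
    assume "\<not> ?thesis"
    then have "eventually (\<lambda>n. norm (f n) \<le> real k * norm (g n)) (at_top_in I)"
      unfolding eventually_at_top_in by (meson not_less)
    then have "f \<in> O[at_top_in I](g)" by (rule bigoI)
    with assms show False by contradiction
  qed
  have "\<exists>s. \<forall>k. (s k \<in> I \<and> norm (f (s k)) > real k * norm (g (s k))) \<and> s k < s (Suc k)"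
  proof (rule dependent_nat_choice)
    show "\<exists>n. n \<in> I \<and> norm (f n) > real 0 * norm (g n)"
      using large[of 0 0] by blast
    show "\<exists>y. (y \<in> I \<and> norm (f y) > real (Suc k) * norm (g y)) \<and> x < y" for x k
      using large[of "Suc x" "Suc k"] by (auto simp: Suc_le_eq)
  qed
  then obtain s where s: "\<And>k. s k \<in> I" "\<And>k. norm (f (s k)) > real k * norm (g (s k))"
    and "\<And>k. s k < s (Suc k)" by blast
  then have mono: "strict_mono s" by (simp add: strict_mono_Suc_iff)
  have "f \<in> \<omega>[at_top_in (range s)](g)"
  proof (rule landau_omega.smallI)
    fix c :: real
    obtain k0 :: nat where k0: "c \<le> real k0" using real_arch_simple by blast
    have "norm (f n) \<ge> c * norm (g n)" if n: "n \<in> range s" "n \<ge> s k0" for n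
    proof -
      obtain k where k: "n = s k" using n(1) by blast
      then have "k0 \<le> k" using n(2) mono by (simp add: strict_mono_less_eq)
      then have "c * norm (g n) \<le> real k * norm (g n)"
        using k0 by (intro mult_right_mono) auto
      then show ?thesis using s(2)[of k] k by simp
    qed
    then show "eventually (\<lambda>n. norm (f n) \<ge> c * norm (g n)) (at_top_in (range s))"
      unfolding eventually_at_top_in by blast
  qed
  moreover have "infinite (range s)" "range s \<subseteq> I"
    using mono s(1) range_inj_infinite strict_mono_imp_inj_on by blast+
  ultimately show ?thesis by blast
qed

section \<open>The dichotomy\<close>

theorem corollary16:
  assumes "\<not> meyniel_conjecture"
  shows
    "(\<forall>I G. graph_family I G \<longrightarrow>
        (\<lambda>n. real (cop_number (G n))) \<in> O[at_top_in I](\<lambda>n. sqrt (real n) * log 2 (real n))) \<or>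
     (\<exists>I G. graph_family I G \<and>
        (\<lambda>n. real (cop_number (G n))) \<in> \<omega>[at_top_in I](\<lambda>n. sqrt (real n) * log 2 (real n)) \<and>
        (\<exists>f :: nat \<Rightarrow> real. f \<in> o[at_top_in I](\<lambda>n. sqrt (real n)) \<and>
           (\<lambda>n. real (num_low_degree (G n) (f n))) \<in> \<omega>[at_top_in I](\<lambda>n. sqrt (real n))))"
proof (rule disj_imp[THEN iffD2], rule impI)
  assume "\<not> (\<forall>I G. graph_family I G \<longrightarrow>
    (\<lambda>n. real (cop_number (G n))) \<in> O[at_top_in I](\<lambda>n. sqrt (real n) * log 2 (real n)))"
  then obtain I G where family: "graph_family I G"
    and notO: "(\<lambda>n. real (cop_number (G n))) \<notin> O[at_top_in I](\<lambda>n. sqrt (real n) * log 2 (real n))"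
    by blast
  obtain J where J: "J \<subseteq> I" "infinite J"
    and large: "(\<lambda>n. real (cop_number (G n))) \<in> \<omega>[at_top_in J](\<lambda>n. sqrt (real n) * log 2 (real n))"
    using not_bigo_imp_smallomega_subset[OF notO] by blast
  have family_J: "graph_family J G"
    using family J by (auto simp: graph_family_def)
  define h where "h n = real (cop_number (G n)) / (sqrt (real n) * log 2 (real n))" for n
  define f where "f n = sqrt (real n) / sqrt (h n)" for n
  have h_large: "eventually (\<lambda>n. n \<ge> 2 \<and> n \<in> J \<and> h n \<ge> c) (at_top_in J)" if "c > 0" for c
  proof -
    have "eventually (\<lambda>n. n \<ge> 2 \<and> n \<in> J) (at_top_in J)"
      unfolding eventually_at_top_in by blast
    with landau_omega.smallD[OF large that] show ?thesis
    proof eventually_elim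
      case (elim n)
      then have "sqrt (real n) * log 2 (real n) > 0" by simp
      then show ?case using elim by (simp add: h_def abs_of_pos le_divide_eq)
    qed
  qed
  have "f \<in> o[at_top_in J](\<lambda>n. sqrt (real n))"
  proof (rule landau_o.smallI)
    fix c :: real
    assume c: "c > 0"
    then have "1 / c\<^sup>2 > 0" by simp
    from h_large[OF this]
    show "eventually (\<lambda>n. norm (f n) \<le> c * norm (sqrt (real n))) (at_top_in J)"
    proof eventually_elim
      case (elim n)
      then have "sqrt (h n) \<ge> 1 / c"
        using c real_le_rsqrt[of "1 / c" "h n"] by (simp add: power_divide)
      moreover from this have "sqrt (h n) > 0"
        using c by (meson less_le_trans zero_less_divide_1_iff)
      ultimately show ?case
        using c mult_left_mono[of 1 "c * sqrt (h n)" "sqrt (real n)"]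
        by (simp add: f_def field_simps)
    qed
  qed
  moreover have "(\<lambda>n. real (num_low_degree (G n) (f n))) \<in> \<omega>[at_top_in J](\<lambda>n. sqrt (real n))"
  proof (rule landau_omega.smallI)
    fix c :: real
    assume c: "c > 0"
    then have "(c + 2)\<^sup>2 > 0" by simp
    from h_large[OF this]
    show "eventually (\<lambda>n. norm (real (num_low_degree (G n) (f n))) \<ge> c * norm (sqrt (real n)))
            (at_top_in J)"
    proof eventually_elim
      case (elim n)
      \<comment> \<open>With \<open>r \<ge> c + 2\<close>, the difference \<open>r\<^sup>2 - r\<close> left after paying for the greedy part is at
        least \<open>c + 1\<close>; the extra 1 absorbs the additive constant in the bound.\<close>
      define r s l where "r = sqrt (h n)" and "s = sqrt (real n)" and "l = log 2 (real n)"
      have r: "r \<ge> c + 2" using elim unfolding r_def by (intro real_le_rsqrt) auto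
      have l1: "l \<ge> 1" using elim by (simp add: l_def le_log_iff)
      have s1: "s \<ge> 1" using elim by (simp add: s_def)
      have n_eq: "real n = s * s" by (simp add: s_def)
      have "h n \<ge> 0" using elim by (meson order_trans zero_le_power2)
      then have "h n = r * r" by (simp add: r_def)
      then have cop: "real (cop_number (G n)) = r * r * (s * l)"
        using s1 l1 unfolding h_def r_def[symmetric] s_def[symmetric] l_def[symmetric]
        by (simp add: field_simps)
      have "ln (real n) \<le> l"
      proof -
        have "ln (real n) * ln 2 \<le> ln (real n)"
          using elim ln_2_less_1 by (intro mult_left_le) auto
        then show ?thesis by (simp add: l_def log_def field_simps)
      qed
      have f_eq: "f n = s / r" by (simp add: f_def r_def s_def)
      have G: "connected_graph (G n)" "card (pverts (G n)) = n"
        using family_J elim by (auto simp: graph_family_def)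
      have "f n > 0" using r s1 c by (simp add: f_eq)
      from cop_number_le_low_degree[OF G(1) this] G(2)
      have "r * r * (s * l) \<le> num_low_degree (G n) (f n) + real n / f n * ln (real n) + 1"
        by (simp add: cop)
      also have "real n / f n = r * s" using s1 by (simp add: n_eq f_eq)
      also have "r * s * ln (real n) \<le> r * s * l"
        using \<open>ln (real n) \<le> l\<close> r s1 c by (intro mult_left_mono) auto
      finally have low: "num_low_degree (G n) (f n) \<ge> (r * (r - 1)) * (s * l) - 1"
        by (simp add: algebra_simps)
      have "r * (r - 1) \<ge> (c + 1) * 1" using r c by (intro mult_mono) auto
      moreover have "s * l \<ge> s * 1" using s1 l1 by (intro mult_left_mono) auto
      ultimately have "(r * (r - 1)) * (s * l) \<ge> (c + 1) * s"
        using c s1 r by (intro mult_mono) auto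
      then have "num_low_degree (G n) (f n) \<ge> c * s"
        using low s1 by (simp add: algebra_simps)
      then show ?case by (simp add: s_def)
    qed
  qed
  ultimately show "\<exists>I G. graph_family I G \<and>
        (\<lambda>n. real (cop_number (G n))) \<in> \<omega>[at_top_in I](\<lambda>n. sqrt (real n) * log 2 (real n)) \<and>
        (\<exists>f :: nat \<Rightarrow> real. f \<in> o[at_top_in I](\<lambda>n. sqrt (real n)) \<and>
           (\<lambda>n. real (num_low_degree (G n) (f n))) \<in> \<omega>[at_top_in I](\<lambda>n. sqrt (real n)))"
    using family_J large by blast
qed

end
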